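(* Let $D$ be a complete commutative normed ring of characteristic $0$ and let $A$ be an associative Banach $D$-algebra with unit $1$. Then the map $x\mapsto x^2$ of $A$ into $A$ is differentiable in the Gâteaux sense, and for every $x\in A$ $$\partial x^2=x\otimes 1+1\otimes x,\qquad \partial x^2\circ dx=x\,dx+dx\,x\quad(dx\in A).$$ Thus the components of the Gâteaux derivative are $$\frac{\partial_{1\cdot 0}x^2}{\partial x}=x,\quad \frac{\partial_{1\cdot 1}x^2}{\partial x}=1,\quad \frac{\partial_{2\cdot 0}x^2}{\partial x}=1,\quad \frac{\partial_{2\cdot 1}x^2}{\partial x}=x.$$
   Context: A norm on a ring $D$ is a map $|\cdot|:D\to\mathbb R$ with $|a|\ge 0$; $|a|=0$ iff $a=0$; $|ab|=|a||b|$; $|a+b|\le|a|+|b|$. $D$ is complete if every Cauchy sequence converges. For a complete normed ring of characteristic $0$ the embedding of $\mathbb Q$ in $D$ is assumed to be a homeomorphism onto its image, and $D$ contains an isomorphic copy of $\mathbb R$. A $D$-algebra $A$ is a $D$-module with a $D$-bilinear product. A norm on $A$ satisfies $|a|\ge 0$; $|a|=0$ iff $a=0$; $|a+b|\le|a|+|b|$; $|ab|=|a||b|$; $|da|=|d||a|$ for $d\in D$. $A$ is a Banach $D$-algebra if it is complete for this norm. A map $f:A\to A$ is differentiable in the Gâteaux sense on $U\subset A$ if for every $x\in U$ one has $f(x+a)-f(x)=\partial f(x)\circ a+o(a)$, where $\partial f(x)$ is a $D$-linear map of the increment $a$ and $o:A\to A$ is a continuous map with $\lim_{a\to 0}|o(a)|/|a|=0$.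 The paper uses interchangeably $\partial f(x)\circ a=\lim_{t\to 0,\,t\in\mathbb R}t^{-1}(f(x+ta)-f(x))$. Here $\circ$ denotes application of a linear map. A tensor $\sum_s p_s\otimes q_s\in A\otimes A$ is identified with the linear map $a\mapsto\sum_s p_s\,a\,q_s$. When $\partial f(x)=\sum_s p_s\otimes q_s$, the elements $p_s=\frac{\partial_{s\cdot 0}f(x)}{\partial x}$ and $q_s=\frac{\partial_{s\cdot 1}f(x)}{\partial x}$ are called components of the Gâteaux derivative. *)

theory Defs
  imports "HOL-Analysis.Analysis" "HOL-Library.Function_Algebras"
begin

text \<open>
  The norms considered here are multiplicative, but the norm of a rational number
  need not be its absolute value: an embedding of the rationals
  that is a homeomorphism onto its image also permits a power of the absolute value with
  exponent in (0,1]. For that reason the classes of real normed algebras are not used.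
\<close>

locale normed_ring =
  fixes nrm :: "'r::ring \<Rightarrow> real"
  assumes nrm_nonneg: "0 \<le> nrm a"
    and nrm_eq_0: "nrm a = 0 \<longleftrightarrow> a = 0"
    and nrm_mult: "nrm (a * b) = nrm a * nrm b"
    and nrm_triangle: "nrm (a + b) \<le> nrm a + nrm b"
begin

lemma nrm_uminus: "nrm (- a) = nrm a"
proof -
  have "(nrm (- a))\<^sup>2 = (nrm a)\<^sup>2"
    using nrm_mult[of "- a" "- a"] nrm_mult[of a a] by (simp add: power2_eq_square)
  then show ?thesis using nrm_nonneg power2_eq_iff_nonneg by blast
qed

sublocale metric: Metric_space UNIV "\<lambda>a b. nrm (a - b)"
proof
  fix x y z :: 'r
  show "0 \<le> nrm (x - y)" by (rule nrm_nonneg)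
  show "nrm (x - y) = nrm (y - x)" using nrm_uminus[of "x - y"] by simp
  show "nrm (x - y) = 0 \<longleftrightarrow> x = y" by (simp add: nrm_eq_0)
  show "nrm (x - z) \<le> nrm (x - y) + nrm (y - z)"
    using nrm_triangle[of "x - y" "y - z"] by simp
qed

end

abbreviation nrm_top :: "('r::ring \<Rightarrow> real) \<Rightarrow> 'r topology" where
  "nrm_top nrm \<equiv> Metric_space.mtopology UNIV (\<lambda>a b. nrm (a - b))"

text \<open>
  The map \<open>\<iota>\<close> gives both embeddings that the ring carries: its restriction to the rationals
  is the only possible ring embedding of the rationals, required to be a homeomorphism onto its
  image, and \<open>\<iota>\<close> itself is the isomorphism of the reals onto a subring. By completeness the
  embedding of the rationals has exactly one continuous extension to the reals; continuity of
  \<open>\<iota>\<close> says that the copy of the reals is this one and not the image of a wild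
  embedding. Injectivity of \<open>\<iota>\<close> is automatic.
\<close>

locale complete_normed_ring_char_0 = normed_ring dnorm
  for dnorm :: "'d::{comm_ring_1, ring_char_0} \<Rightarrow> real" +
  fixes \<iota> :: "real \<Rightarrow> 'd"
  assumes complete: "metric.mcomplete"
    and \<iota>_add: "\<iota> (s + t) = \<iota> s + \<iota> t"
    and \<iota>_mult: "\<iota> (s * t) = \<iota> s * \<iota> t"
    and \<iota>_one: "\<iota> 1 = 1"
    and \<iota>_rat_embedding: "embedding_map (top_of_set \<rat>) (nrm_top dnorm) \<iota>"
    and \<iota>_continuous: "continuous_map euclidean (nrm_top dnorm) \<iota>"

text \<open>
  The sort \<open>{ring, monoid_mult}\<close> is that of associative rings with unit; unlike
  \<open>ring_1\<close> it does not exclude the zero ring.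
\<close>

locale banach_algebra = module smul + normed_ring anorm
  for smul :: "'d::comm_ring_1 \<Rightarrow> 'a::{ring, monoid_mult} \<Rightarrow> 'a"
    and dnorm :: "'d \<Rightarrow> real"
    and anorm :: "'a \<Rightarrow> real" +
  assumes scale_mult_left: "smul d a * b = smul d (a * b)"
    and scale_mult_right: "a * smul d b = smul d (a * b)"
    and anorm_scale: "anorm (smul d a) = dnorm d * anorm a"
    and complete: "metric.mcomplete"

definition has_gateaux_derivative ::
    "('d::comm_ring_1 \<Rightarrow> 'a::ring \<Rightarrow> 'a) \<Rightarrow> ('a \<Rightarrow> real) \<Rightarrow> ('a \<Rightarrow> 'a) \<Rightarrow> 'a \<Rightarrow> ('a \<Rightarrow> 'a) \<Rightarrow> bool" where
  "has_gateaux_derivative smul anorm f x F \<longleftrightarrow>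
     module_hom smul smul F \<and>
     (\<exists>r. continuous_map (nrm_top anorm) (nrm_top anorm) r \<and>
          (\<forall>a. f (x + a) - f x = F a + r a) \<and>
          ((\<lambda>a. anorm (r a) / anorm a) \<longlongrightarrow> 0) (atin (nrm_top anorm) 0))"

definition gateaux_differentiable_on ::
    "('d::comm_ring_1 \<Rightarrow> 'a::ring \<Rightarrow> 'a) \<Rightarrow> ('a \<Rightarrow> real) \<Rightarrow> ('a \<Rightarrow> 'a) \<Rightarrow> 'a set \<Rightarrow> bool" where
  "gateaux_differentiable_on smul anorm f U \<longleftrightarrow>
     (\<forall>x\<in>U. \<exists>F. has_gateaux_derivative smul anorm f x F)"

definition gateaux_derivative ::
    "('d::comm_ring_1 \<Rightarrow> 'a::ring \<Rightarrow> 'a) \<Rightarrow> ('a \<Rightarrow> real) \<Rightarrow> ('a \<Rightarrow> 'a) \<Rightarrow> 'a \<Rightarrow> 'a \<Rightarrow> 'a" where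
  "gateaux_derivative smul anorm f x = (THE F. has_gateaux_derivative smul anorm f x F)"

text \<open>The directional form of the derivative, with \<open>\<iota>\<close> the embedding of the reals in the
  scalars: the limit of \<open>(f (x + t a) - f x) / t\<close> for real \<open>t\<close> tending to 0.\<close>

definition has_directional_limit ::
    "(real \<Rightarrow> 'd) \<Rightarrow> ('d \<Rightarrow> 'a \<Rightarrow> 'a) \<Rightarrow> ('a::ring \<Rightarrow> real) \<Rightarrow> ('a \<Rightarrow> 'a) \<Rightarrow> 'a \<Rightarrow> 'a \<Rightarrow> 'a \<Rightarrow> bool" where
  "has_directional_limit \<iota> smul anorm f x a l \<longleftrightarrow>
     limitin (nrm_top anorm) (\<lambda>t. smul (\<iota> (inverse t)) (f (x + smul (\<iota> t) a) - f x)) l (at 0)"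

text \<open>A tensor stands for the linear map it is identified with; sums of tensors are
  pointwise sums of functions.\<close>

definition tensor :: "'a::ring \<Rightarrow> 'a \<Rightarrow> 'a \<Rightarrow> 'a" (infix "\<otimes>" 68) where
  "p \<otimes> q = (\<lambda>a. p * a * q)"

text \<open>\<open>c s 0\<close> and \<open>c s 1\<close> are the two components with index \<open>s\<close>, for \<open>s = 1, ..., n\<close>. A family of
  components is not determined by \<open>f\<close> and \<open>x\<close>, hence a predicate.\<close>

definition gateaux_components ::
    "('d::comm_ring_1 \<Rightarrow> 'a::ring \<Rightarrow> 'a) \<Rightarrow> ('a \<Rightarrow> real) \<Rightarrow> ('a \<Rightarrow> 'a) \<Rightarrow> 'a \<Rightarrow> nat \<Rightarrow> (nat \<Rightarrow> nat \<Rightarrow> 'a) \<Rightarrow> bool" where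
  "gateaux_components smul anorm f x n c \<longleftrightarrow>
     gateaux_derivative smul anorm f x = (\<Sum>s=1..n. c s 0 \<otimes> c s 1)"

end

theory Submission
  imports Defs
begin

text \<open>
  Expanding \<open>(x + a)\<^sup>2\<close> without commuting factors gives
  \<open>(x + a)\<^sup>2 - x\<^sup>2 = (x * a + a * x) + a\<^sup>2\<close>. The first summand is linear in \<open>a\<close> over the
  scalars, because these commute with every element of the algebra. The second summand is an
  admissible remainder: it is continuous, and since the norm is multiplicative its norm
  divided by that of \<open>a\<close> is the norm of \<open>a\<close> itself.

  To speak of \<^emph>\<open>the\<close> derivative, and hence of its components, one also needs uniqueness. It comes
  from the scalars containing arbitrarily small invertible elements, the images of small
  reals \<open>t\<close>: by linearity the derivative in direction \<open>a\<close> is recovered from the difference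
  quotients along \<open>t a\<close>, so it is the directional limit, and limits in a metric
  space are unique. Thus \<open>gateaux_imp_directional_limit\<close> gives both uniqueness and the
  directional formula.
\<close>

locale banach_algebra_char_0 =
  D: complete_normed_ring_char_0 dnorm \<iota> + A: banach_algebra smul dnorm anorm
  for dnorm :: "'d::{comm_ring_1, ring_char_0} \<Rightarrow> real"
    and \<iota> :: "real \<Rightarrow> 'd"
    and smul :: "'d \<Rightarrow> 'a::{ring, monoid_mult} \<Rightarrow> 'a"
    and anorm :: "'a \<Rightarrow> real"
begin

lemma \<iota>_zero: "\<iota> 0 = 0"
  using D.\<iota>_add[of 0 0] by simp

lemma \<iota>_inverse_mult:
  assumes "t \<noteq> 0"
  shows "\<iota> (inverse t) * \<iota> t = 1"
  using assms by (simp flip: D.\<iota>_mult add: D.\<iota>_one)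

lemma dnorm_one: "dnorm 1 = 1"
  using D.nrm_mult[of 1 1] D.nrm_eq_0[of 1] by simp

lemma dnorm_\<iota>_pos:
  assumes "t \<noteq> 0"
  shows "0 < dnorm (\<iota> t)"
proof -
  have "\<iota> t \<noteq> 0"
    using \<iota>_inverse_mult[OF assms] by auto
  then show ?thesis
    using D.nrm_nonneg[of "\<iota> t"] D.nrm_eq_0[of "\<iota> t"] by linarith
qed

text \<open>The norm of the scalar \<open>t\<close> need not be the absolute value of \<open>t\<close>, so that it becomes small
  is a consequence of the continuity of the embedding.\<close>

lemma dnorm_\<iota>_tendsto_0: "((\<lambda>t. dnorm (\<iota> t)) \<longlongrightarrow> 0) (at 0)"
proof (rule tendstoI)
  fix e :: real
  assume "0 < e"
  then obtain U where U: "open U" "0 \<in> U"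
    and ball: "\<And>t. t \<in> U \<Longrightarrow> \<iota> t \<in> D.metric.mball (\<iota> 0) e"
    using D.\<iota>_continuous unfolding D.metric.continuous_map_to_metric
    by (metis UNIV_I open_openin topspace_euclidean)
  have "dnorm (\<iota> t) < e" if "t \<in> U" for t
    using ball[OF that] by (simp add: \<iota>_zero D.nrm_uminus)
  then show "\<forall>\<^sub>F t in at 0. dist (dnorm (\<iota> t)) 0 < e"
    unfolding eventually_at_topological using U D.nrm_nonneg by auto
qed

lemma filterlim_scale_atin_0:
  assumes "a \<noteq> 0"
  shows "filterlim (\<lambda>t. smul (\<iota> t) a) (atin (nrm_top anorm) 0) (at 0)"
proof -
  have "\<forall>\<^sub>F t in at 0. P (smul (\<iota> t) a)"
    if P: "eventually P (atin (nrm_top anorm) 0)" for P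
  proof -
    obtain \<delta> where "0 < \<delta>" and \<delta>: "\<And>h. 0 < anorm h \<Longrightarrow> anorm h < \<delta> \<Longrightarrow> P h"
      using P unfolding A.metric.eventually_atin_metric by auto
    have "((\<lambda>t. dnorm (\<iota> t) * anorm a) \<longlongrightarrow> 0) (at 0)"
      using tendsto_mult_left_zero[OF dnorm_\<iota>_tendsto_0] .
    then have "\<forall>\<^sub>F t in at 0. dnorm (\<iota> t) * anorm a < \<delta>"
      using \<open>0 < \<delta>\<close> by (rule order_tendstoD(2))
    moreover have "\<forall>\<^sub>F t in at (0::real). t \<noteq> 0"
      by (simp add: eventually_at_filter)
    ultimately show ?thesis
    proof eventually_elim
      case (elim t)
      have "0 < anorm a"
        using assms A.nrm_nonneg[of a] A.nrm_eq_0[of a] by linarith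
      then show ?case
        using \<delta>[of "smul (\<iota> t) a"] elim dnorm_\<iota>_pos[of t] by (simp add: A.anorm_scale)
    qed
  qed
  then show ?thesis
    by (simp add: filterlim_iff)
qed

text \<open>For \<open>a \<noteq> 0\<close> and \<open>h = t a\<close>, the difference quotient differs from \<open>F a\<close> by \<open>r h / t\<close>, whose norm is
  \<open>|r h| / |h|\<close> times the constant \<open>|a|\<close>.\<close>

lemma gateaux_imp_directional_limit:
  assumes "has_gateaux_derivative smul anorm f x F"
  shows "has_directional_limit \<iota> smul anorm f x a (F a)"
proof -
  interpret F: module_hom smul smul F
    using assms by (simp add: has_gateaux_derivative_def)
  obtain r where r: "\<And>h. f (x + h) - f x = F h + r h"
    and small: "((\<lambda>h. anorm (r h) / anorm h) \<longlongrightarrow> 0) (atin (nrm_top anorm) 0)"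
    using assms by (auto simp: has_gateaux_derivative_def)
  let ?h = "\<lambda>t. smul (\<iota> t) a"
  let ?q = "\<lambda>t. smul (\<iota> (inverse t)) (f (x + ?h t) - f x)"
  have "((\<lambda>t. anorm (?q t - F a)) \<longlongrightarrow> 0) (at 0)"
  proof (cases "a = 0")
    case True
    then show ?thesis
      by (simp add: F.zero A.nrm_eq_0[THEN iffD2])
  next
    case False
    have "anorm (?q t - F a) = anorm a * (anorm (r (?h t)) / anorm (?h t))" if "t \<noteq> 0" for t
    proof -
      have "?q t - F a = smul (\<iota> (inverse t)) (r (?h t))"
        using \<iota>_inverse_mult[OF that] by (simp add: r F.scale A.scale_right_distrib)
      moreover have "dnorm (\<iota> (inverse t)) * dnorm (\<iota> t) = 1"
        using \<iota>_inverse_mult[OF that] by (simp flip: D.nrm_mult add: dnorm_one)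
      ultimately show ?thesis
        using False dnorm_\<iota>_pos[OF that] A.nrm_eq_0[of a]
        by (simp add: A.anorm_scale field_simps)
    qed
    then have "\<forall>\<^sub>F t in at 0.
        anorm a * (anorm (r (?h t)) / anorm (?h t)) = anorm (?q t - F a)"
      by (simp add: eventually_at_filter)
    moreover have "((\<lambda>t. anorm a * (anorm (r (?h t)) / anorm (?h t))) \<longlongrightarrow> 0) (at 0)"
      using filterlim_compose[OF small filterlim_scale_atin_0[OF False]]
      by (rule tendsto_mult_right_zero)
    ultimately show ?thesis
      by (rule Lim_transform_eventually[rotated])
  qed
  then show ?thesis
    by (simp add: has_directional_limit_def A.metric.limitin_metric_dist_null)
qed

lemma gateaux_derivative_eqI:
  assumes "has_gateaux_derivative smul anorm f x F"
  shows "gateaux_derivative smul anorm f x = F"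
  unfolding gateaux_derivative_def
proof (rule the_equality)
  fix G
  assume "has_gateaux_derivative smul anorm f x G"
  then have "has_directional_limit \<iota> smul anorm f x a (G a)" for a
    by (rule gateaux_imp_directional_limit)
  moreover have "has_directional_limit \<iota> smul anorm f x a (F a)" for a
    using assms by (rule gateaux_imp_directional_limit)
  ultimately have "G a = F a" for a
    unfolding has_directional_limit_def
    by (rule A.metric.limitin_metric_unique) simp
  then show "G = F"
    by (rule ext)
qed (rule assms)

end

lemma (in normed_ring) continuous_map_mult_self:
  "continuous_map (nrm_top nrm) (nrm_top nrm) (\<lambda>a. a * a)"
proof -
  have "\<exists>\<delta>>0. \<forall>b. nrm (a - b) < \<delta> \<longrightarrow> nrm (a * a - b * b) < e" if "0 < e" for a e
  proof -
    let ?C = "2 * nrm a + 1"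
    have C: "0 < ?C"
      using nrm_nonneg[of a] by linarith
    have "nrm (a * a - b * b) < e" if b: "nrm (a - b) < min 1 (e / ?C)" for b
    proof -
      let ?d = "a - b"
      have "nrm b \<le> nrm a + nrm ?d"
        using nrm_triangle[of a "- ?d"] nrm_uminus[of ?d] by simp
      then have le: "nrm a + nrm b \<le> ?C"
        using b by simp
      have "a * a - b * b = a * ?d + ?d * b"
        by (simp add: algebra_simps)
      then have "nrm (a * a - b * b) \<le> (nrm a + nrm b) * nrm ?d"
        using nrm_triangle[of "a * ?d" "?d * b"] by (simp add: nrm_mult distrib_left distrib_right mult.commute)
      also have "\<dots> \<le> ?C * nrm ?d"
        using le nrm_nonneg by (rule mult_right_mono)
      also have "\<dots> < e"
        using b C by (simp add: field_simps)
      finally show ?thesis .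
    qed
    moreover have "0 < min 1 (e / ?C)"
      using C that by simp
    ultimately show ?thesis
      by blast
  qed
  then show ?thesis
    by (simp add: metric.metric_continuous_map[OF metric.Metric_space_axioms])
qed

lemma (in banach_algebra) has_gateaux_derivative_square:
  "has_gateaux_derivative smul anorm (\<lambda>x. x\<^sup>2) x (x \<otimes> 1 + 1 \<otimes> x)"
  unfolding has_gateaux_derivative_def
proof (intro conjI exI[of _ "\<lambda>a. a * a"] allI)
  show "module_hom smul smul (x \<otimes> 1 + 1 \<otimes> x)"
    by (simp add: module_hom_iff module_axioms tensor_def algebra_simps
        scale_mult_left scale_mult_right scale_right_distrib)
  show "continuous_map (nrm_top anorm) (nrm_top anorm) (\<lambda>a. a * a)"
    by (rule continuous_map_mult_self)
  show "(x + a)\<^sup>2 - x\<^sup>2 = (x \<otimes> 1 + 1 \<otimes> x) a + a * a" for a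
    by (simp add: tensor_def power2_eq_square algebra_simps)
  have "anorm (a * a) / anorm a = anorm a" for a
    by (simp add: nrm_mult)
  moreover have "(anorm \<longlongrightarrow> 0) (atin (nrm_top anorm) 0)"
    unfolding tendsto_iff metric.eventually_atin_metric by (auto simp: nrm_nonneg)
  ultimately show "((\<lambda>a. anorm (a * a) / anorm a) \<longlongrightarrow> 0) (atin (nrm_top anorm) 0)"
    by simp
qed

theorem theorem4p36:
  fixes dnorm :: "'d::{comm_ring_1, ring_char_0} \<Rightarrow> real"
    and \<iota> :: "real \<Rightarrow> 'd"
    and smul :: "'d \<Rightarrow> 'a::{ring, monoid_mult} \<Rightarrow> 'a"
    and anorm :: "'a \<Rightarrow> real"
  assumes D: "complete_normed_ring_char_0 dnorm \<iota>"
    and A: "banach_algebra smul dnorm anorm"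
  shows "gateaux_differentiable_on smul anorm (\<lambda>x. x\<^sup>2) UNIV \<and>
    (\<forall>x. gateaux_derivative smul anorm (\<lambda>x. x\<^sup>2) x = x \<otimes> 1 + 1 \<otimes> x \<and>
         (\<forall>dx. gateaux_derivative smul anorm (\<lambda>x. x\<^sup>2) x dx = x * dx + dx * x \<and>
               has_directional_limit \<iota> smul anorm (\<lambda>x. x\<^sup>2) x dx (x * dx + dx * x)) \<and>
         (\<exists>c. gateaux_components smul anorm (\<lambda>x. x\<^sup>2) x 2 c \<and>
              c 1 0 = x \<and> c 1 1 = 1 \<and> c 2 0 = 1 \<and> c 2 1 = x))"
proof -
  interpret banach_algebra_char_0 dnorm \<iota> smul anorm
    using D A by (rule banach_algebra_char_0.intro)
  note deriv = A.has_gateaux_derivative_square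
  have eq: "gateaux_derivative smul anorm (\<lambda>x. x\<^sup>2) x = x \<otimes> 1 + 1 \<otimes> x" for x
    using deriv by (rule gateaux_derivative_eqI)
  have app: "(x \<otimes> 1 + 1 \<otimes> x) a = x * a + a * x" for x a :: 'a
    by (simp add: tensor_def)
  have "gateaux_differentiable_on smul anorm (\<lambda>x. x\<^sup>2) UNIV"
    unfolding gateaux_differentiable_on_def using deriv by blast
  moreover have "has_directional_limit \<iota> smul anorm (\<lambda>x. x\<^sup>2) x a (x * a + a * x)" for x a
    using gateaux_imp_directional_limit[OF deriv] by (simp only: app)
  moreover have "\<exists>c. gateaux_components smul anorm (\<lambda>x. x\<^sup>2) x 2 c \<and>
      c 1 0 = x \<and> c 1 1 = 1 \<and> c 2 0 = 1 \<and> c 2 1 = x" for x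
  proof -
    let ?c = "\<lambda>s i :: nat. if (s = 1) = (i = 0) then x else 1"
    have "{1..2} = {1, 2 :: nat}"
      by auto
    then have "gateaux_components smul anorm (\<lambda>x. x\<^sup>2) x 2 ?c"
      by (simp add: gateaux_components_def eq)
    then show ?thesis
      by (intro exI[of _ ?c]) simp
  qed
  ultimately show ?thesis
    by (simp only: eq app simp_thms)
qed

end
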